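(* Normal-form bisimilarity is sound with respect to contextual equivalence: for all terms $t_0,t_1$ of $\lambda_S$, if $t_0\approx_{nf}t_1$ then $t_0\cong^\circ t_1$ (which for closed terms is $t_0\cong t_1$).
   Context: Calculus $\lambda_S$: terms $t ::= v \mid t\,t \mid \mathcal{S}k.t \mid \langle t\rangle$, values $v ::= x \mid \lambda x.t$; pure contexts $E ::= \square \mid v\,E \mid E\,t$; evaluation contexts $F ::= \square \mid v\,F \mid F\,t \mid \langle F\rangle$ (each is either pure or uniquely $F[\langle E\rangle]$ with $E$ pure); contexts $C ::= \square \mid \lambda x.C \mid t\,C \mid C\,t \mid \mathcal{S}k.C \mid \langle C\rangle$. Reduction (on open terms): $F[(\lambda x.t)\,v] \to F[t\{v/x\}]$; $F[\langle E[\mathcal{S}k.t]\rangle] \to F[\langle t\{\lambda x.\langle E[x]\rangle/k\}\rangle]$ ($x\notin\mathrm{fv}(E)$); $F[\langle v\rangle]\to F[v]$. Stuck terms are exactly control-stuck terms $E[\mathcal{S}k.t]$ and open-stuck terms $F[x\,v]$; normal form: value or stuck term; $t\Downarrow t'$: $t\to^* t'$ with $t'$ normal form. Contextual equivalence on closed terms: $t_0\cong t_1$ iff for every closed $C$, $C[t_0]$ evaluates to a value iff $C[t_1]$ does, and $C[t_0]$ evaluates to a control-stuck term iff $C[t_1]$ does; $t_0\cong^\circ t_1$ iff $t_0\sigma\cong t_1\sigma$ for every substitution $\sigma$ of closed values for the free variables. Extensions of a relation $R$ on open terms ($x$ always a fresh variable): $E_0\,R^c\,E_1$ (pure) iff $E_0[x]\,R\,E_1[x]$;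 $F_0[\langle E_0\rangle]\,R^c\,F_1[\langle E_1\rangle]$ iff $\langle E_0[x]\rangle\,R\,\langle E_1[x]\rangle$ and $F_0[x]\,R\,F_1[x]$ ($R^c$ relates no other pairs); $v_0\,R^v\,v_1$ iff $v_0\,x\,R\,v_1\,x$; $E_0[\mathcal{S}k.t_0]\,R^{nf}\,E_1[\mathcal{S}k.t_1]$ iff $E_0\,R^c\,E_1$ and $\langle t_0\rangle\,R\,\langle t_1\rangle$; $F_0[y\,v_0]\,R^{nf}\,F_1[y\,v_1]$ iff $F_0\,R^c\,F_1$ and $v_0\,R^v\,v_1$. A normal-form bisimulation is a relation $R$ on open terms such that $t_0\,R\,t_1$ implies: if $t_0\to t_0'$ then $t_1\to^*t_1'$ with $t_0'\,R\,t_1'$; if $t_0$ is a value then $t_1\Downarrow v_1$ for a value $v_1$ with $t_0\,R^v\,v_1$; if $t_0$ is stuck then $t_1\Downarrow t_1'$ with $t_0\,R^{nf}\,t_1'$; and the symmetric conditions for $t_1$. $\approx_{nf}$ is the largest normal-form bisimulation. *)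

theory Defs
  imports Main
begin

text \<open>
  Terms are in de Bruijn form, so syntactic equality is equality up to renaming of bound variables:
  \<open>Lam\<close> and \<open>Shift\<close> bind index 0 of their body, and the indices that are not bound are the free
  variables. A variable that is fresh for some terms is obtained by renaming those terms along
  \<open>Suc\<close> and taking index 0.
\<close>

datatype trm = Val val | App trm trm | Shift trm | Reset trm
  and val = Var nat | Lam trm

primrec fv_trm :: "trm \<Rightarrow> nat set" and fv_val :: "val \<Rightarrow> nat set" where
  "fv_trm (Val v) = fv_val v"
| "fv_trm (App t u) = fv_trm t \<union> fv_trm u"
| "fv_trm (Shift t) = {n. Suc n \<in> fv_trm t}"
| "fv_trm (Reset t) = fv_trm t"
| "fv_val (Var n) = {n}"
| "fv_val (Lam t) = {n. Suc n \<in> fv_trm t}"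

definition closed_trm :: "trm \<Rightarrow> bool" where
  "closed_trm t \<longleftrightarrow> fv_trm t = {}"

definition closed_val :: "val \<Rightarrow> bool" where
  "closed_val v \<longleftrightarrow> fv_val v = {}"

definition up_ren :: "(nat \<Rightarrow> nat) \<Rightarrow> nat \<Rightarrow> nat" where
  "up_ren r = case_nat 0 (\<lambda>n. Suc (r n))"

primrec ren_trm :: "(nat \<Rightarrow> nat) \<Rightarrow> trm \<Rightarrow> trm" and ren_val :: "(nat \<Rightarrow> nat) \<Rightarrow> val \<Rightarrow> val" where
  "ren_trm r (Val v) = Val (ren_val r v)"
| "ren_trm r (App t u) = App (ren_trm r t) (ren_trm r u)"
| "ren_trm r (Shift t) = Shift (ren_trm (up_ren r) t)"
| "ren_trm r (Reset t) = Reset (ren_trm r t)"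
| "ren_val r (Var n) = Var (r n)"
| "ren_val r (Lam t) = Lam (ren_trm (up_ren r) t)"

definition up_subst :: "(nat \<Rightarrow> val) \<Rightarrow> nat \<Rightarrow> val" where
  "up_subst s = case_nat (Var 0) (\<lambda>n. ren_val Suc (s n))"

text \<open>Simultaneous capture-avoiding substitution of values for all free variables.\<close>

primrec subst_trm :: "(nat \<Rightarrow> val) \<Rightarrow> trm \<Rightarrow> trm" and subst_val :: "(nat \<Rightarrow> val) \<Rightarrow> val \<Rightarrow> val" where
  "subst_trm s (Val v) = Val (subst_val s v)"
| "subst_trm s (App t u) = App (subst_trm s t) (subst_trm s u)"
| "subst_trm s (Shift t) = Shift (subst_trm (up_subst s) t)"
| "subst_trm s (Reset t) = Reset (subst_trm s t)"
| "subst_val s (Var n) = s n"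
| "subst_val s (Lam t) = Lam (subst_trm (up_subst s) t)"

text \<open>\<open>t{v/x}\<close> for the body \<open>t\<close> of a binder of \<open>x\<close>: index 0 is replaced by \<open>v\<close> and the other
  indices are decremented, since the binder disappears.\<close>

definition inst :: "val \<Rightarrow> trm \<Rightarrow> trm" where
  "inst v t = subst_trm (case_nat v Var) t"


subsection \<open>Evaluation contexts\<close>

datatype ectx = Hole | AppR val ectx | AppL ectx trm | ResetE ectx

primrec is_pure :: "ectx \<Rightarrow> bool" where
  "is_pure Hole \<longleftrightarrow> True"
| "is_pure (AppR v F) \<longleftrightarrow> is_pure F"
| "is_pure (AppL F t) \<longleftrightarrow> is_pure F"
| "is_pure (ResetE F) \<longleftrightarrow> False"

primrec plug :: "ectx \<Rightarrow> trm \<Rightarrow> trm" where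
  "plug Hole t = t"
| "plug (AppR v F) t = App (Val v) (plug F t)"
| "plug (AppL F u) t = App (plug F t) u"
| "plug (ResetE F) t = Reset (plug F t)"

primrec comp_ectx :: "ectx \<Rightarrow> ectx \<Rightarrow> ectx" where
  "comp_ectx Hole G = G"
| "comp_ectx (AppR v F) G = AppR v (comp_ectx F G)"
| "comp_ectx (AppL F u) G = AppL (comp_ectx F G) u"
| "comp_ectx (ResetE F) G = ResetE (comp_ectx F G)"

primrec ren_ectx :: "(nat \<Rightarrow> nat) \<Rightarrow> ectx \<Rightarrow> ectx" where
  "ren_ectx r Hole = Hole"
| "ren_ectx r (AppR v F) = AppR (ren_val r v) (ren_ectx r F)"
| "ren_ectx r (AppL F t) = AppL (ren_ectx r F) (ren_trm r t)"
| "ren_ectx r (ResetE F) = ResetE (ren_ectx r F)"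

text \<open>\<open>F[x]\<close> for the fresh variable \<open>x\<close> of index 0.\<close>

definition plug_fresh :: "ectx \<Rightarrow> trm" where
  "plug_fresh F = plug (ren_ectx Suc F) (Val (Var 0))"


subsection \<open>Reduction and normal forms\<close>

inductive red :: "trm \<Rightarrow> trm \<Rightarrow> bool" where
  red_beta: "red (plug F (App (Val (Lam t)) (Val v))) (plug F (inst v t))"
| red_shift: "is_pure E \<Longrightarrow>
    red (plug F (Reset (plug E (Shift t))))
        (plug F (Reset (inst (Lam (Reset (plug_fresh E))) t)))"
| red_reset: "red (plug F (Reset (Val v))) (plug F (Val v))"

definition is_value :: "trm \<Rightarrow> bool" where
  "is_value t \<longleftrightarrow> (\<exists>v. t = Val v)"

definition control_stuck :: "trm \<Rightarrow> bool" where
  "control_stuck t \<longleftrightarrow> (\<exists>E u. is_pure E \<and> t = plug E (Shift u))"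

definition open_stuck :: "trm \<Rightarrow> bool" where
  "open_stuck t \<longleftrightarrow> (\<exists>F x v. t = plug F (App (Val (Var x)) (Val v)))"

definition stuck :: "trm \<Rightarrow> bool" where
  "stuck t \<longleftrightarrow> control_stuck t \<or> open_stuck t"

definition normal_form :: "trm \<Rightarrow> bool" where
  "normal_form t \<longleftrightarrow> is_value t \<or> stuck t"

definition evals_to :: "trm \<Rightarrow> trm \<Rightarrow> bool" where
  "evals_to t t' \<longleftrightarrow> red\<^sup>*\<^sup>* t t' \<and> normal_form t'"


subsection \<open>Contextual equivalence\<close>

datatype ctx = CHole | CLam ctx | CAppR trm ctx | CAppL ctx trm | CShift ctx | CReset ctx

text \<open>Filling does not rename the argument, so free indices of the argument may be captured.\<close>

primrec fill :: "ctx \<Rightarrow> trm \<Rightarrow> trm" where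
  "fill CHole t = t"
| "fill (CLam C) t = Val (Lam (fill C t))"
| "fill (CAppR u C) t = App u (fill C t)"
| "fill (CAppL C u) t = App (fill C t) u"
| "fill (CShift C) t = Shift (fill C t)"
| "fill (CReset C) t = Reset (fill C t)"

primrec fv_ctx :: "ctx \<Rightarrow> nat set" where
  "fv_ctx CHole = {}"
| "fv_ctx (CLam C) = {n. Suc n \<in> fv_ctx C}"
| "fv_ctx (CAppR t C) = fv_trm t \<union> fv_ctx C"
| "fv_ctx (CAppL C t) = fv_ctx C \<union> fv_trm t"
| "fv_ctx (CShift C) = {n. Suc n \<in> fv_ctx C}"
| "fv_ctx (CReset C) = fv_ctx C"

definition closed_ctx :: "ctx \<Rightarrow> bool" where
  "closed_ctx C \<longleftrightarrow> fv_ctx C = {}"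

definition ctx_equiv :: "trm \<Rightarrow> trm \<Rightarrow> bool" where
  "ctx_equiv t0 t1 \<longleftrightarrow>
     closed_trm t0 \<and> closed_trm t1 \<and>
     (\<forall>C. closed_ctx C \<longrightarrow>
        ((\<exists>u. evals_to (fill C t0) u \<and> is_value u) \<longleftrightarrow>
         (\<exists>u. evals_to (fill C t1) u \<and> is_value u)) \<and>
        ((\<exists>u. evals_to (fill C t0) u \<and> control_stuck u) \<longleftrightarrow>
         (\<exists>u. evals_to (fill C t1) u \<and> control_stuck u)))"

definition open_ctx_equiv :: "trm \<Rightarrow> trm \<Rightarrow> bool" where
  "open_ctx_equiv t0 t1 \<longleftrightarrow>
     (\<forall>s. (\<forall>x \<in> fv_trm t0 \<union> fv_trm t1. closed_val (s x)) \<longrightarrow>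
        ctx_equiv (subst_trm s t0) (subst_trm s t1))"


lemma subst_fv_id:
  "(\<And>x. x \<in> fv_trm t \<Longrightarrow> s x = Var x) \<Longrightarrow> subst_trm s t = t"
  "(\<And>x. x \<in> fv_val v \<Longrightarrow> s x = Var x) \<Longrightarrow> subst_val s v = v"
proof (induction t and v arbitrary: s and s)
  case (Shift t)
  have "up_subst s x = Var x" if "x \<in> fv_trm t" for x
    using that Shift.prems by (cases x) (simp_all add: up_subst_def)
  then show ?case using Shift.IH by simp
next
  case (Lam t)
  have "up_subst s x = Var x" if "x \<in> fv_trm t" for x
    using that Lam.prems by (cases x) (simp_all add: up_subst_def)
  then show ?case using Lam.IH by simp
qed simp_all

lemma open_ctx_equiv_closed:
  assumes "closed_trm t0" "closed_trm t1"
  shows "open_ctx_equiv t0 t1 \<longleftrightarrow> ctx_equiv t0 t1"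
proof -
  have "subst_trm s t0 = t0" "subst_trm s t1 = t1" for s
    using assms by (auto simp: closed_trm_def intro: subst_fv_id(1))
  then show ?thesis using assms by (simp add: open_ctx_equiv_def closed_trm_def)
qed


subsection \<open>Normal-form bisimilarity\<close>

type_synonym trm_rel = "trm \<Rightarrow> trm \<Rightarrow> bool"

inductive ext_ctx :: "trm_rel \<Rightarrow> ectx \<Rightarrow> ectx \<Rightarrow> bool" for R where
  ext_ctx_pure: "is_pure E0 \<Longrightarrow> is_pure E1 \<Longrightarrow> R (plug_fresh E0) (plug_fresh E1) \<Longrightarrow> ext_ctx R E0 E1"
| ext_ctx_reset: "is_pure E0 \<Longrightarrow> is_pure E1 \<Longrightarrow>
    R (Reset (plug_fresh E0)) (Reset (plug_fresh E1)) \<Longrightarrow>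
    R (plug_fresh F0) (plug_fresh F1) \<Longrightarrow>
    ext_ctx R (comp_ectx F0 (ResetE E0)) (comp_ectx F1 (ResetE E1))"

definition ext_val :: "trm_rel \<Rightarrow> val \<Rightarrow> val \<Rightarrow> bool" where
  "ext_val R v0 v1 \<longleftrightarrow>
     R (App (Val (ren_val Suc v0)) (Val (Var 0))) (App (Val (ren_val Suc v1)) (Val (Var 0)))"

text \<open>In the first rule the fresh variable of index 0 in the bodies plays the role of \<open>k\<close>.\<close>

inductive ext_nf :: "trm_rel \<Rightarrow> trm \<Rightarrow> trm \<Rightarrow> bool" for R where
  ext_nf_control: "is_pure E0 \<Longrightarrow> is_pure E1 \<Longrightarrow> ext_ctx R E0 E1 \<Longrightarrow> R (Reset t0) (Reset t1) \<Longrightarrow>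
    ext_nf R (plug E0 (Shift t0)) (plug E1 (Shift t1))"
| ext_nf_open: "ext_ctx R F0 F1 \<Longrightarrow> ext_val R v0 v1 \<Longrightarrow>
    ext_nf R (plug F0 (App (Val (Var y)) (Val v0))) (plug F1 (App (Val (Var y)) (Val v1)))"

definition nf_simulation :: "trm_rel \<Rightarrow> bool" where
  "nf_simulation R \<longleftrightarrow> (\<forall>t0 t1. R t0 t1 \<longrightarrow>
     (\<forall>t0'. red t0 t0' \<longrightarrow> (\<exists>t1'. red\<^sup>*\<^sup>* t1 t1' \<and> R t0' t1')) \<and>
     (\<forall>v0. t0 = Val v0 \<longrightarrow> (\<exists>v1. evals_to t1 (Val v1) \<and> ext_val R v0 v1)) \<and>
     (stuck t0 \<longrightarrow> (\<exists>t1'. evals_to t1 t1' \<and> ext_nf R t0 t1')))"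

definition nf_bisimulation :: "trm_rel \<Rightarrow> bool" where
  "nf_bisimulation R \<longleftrightarrow> nf_simulation R \<and> nf_simulation R\<inverse>\<inverse>"

definition nf_bisimilar :: trm_rel where
  "nf_bisimilar t0 t1 \<longleftrightarrow> (\<exists>R. nf_bisimulation R \<and> R t0 t1)"

lemma ext_ctx_mono: "ext_ctx R F0 F1 \<Longrightarrow> R \<le> S \<Longrightarrow> ext_ctx S F0 F1"
  by (induction rule: ext_ctx.induct) (blast intro: ext_ctx.intros)+

lemma ext_val_mono: "ext_val R v0 v1 \<Longrightarrow> R \<le> S \<Longrightarrow> ext_val S v0 v1"
  unfolding ext_val_def by blast

lemma ext_nf_mono: "ext_nf R t0 t1 \<Longrightarrow> R \<le> S \<Longrightarrow> ext_nf S t0 t1"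
  by (induction rule: ext_nf.induct) (blast intro: ext_nf.intros ext_ctx_mono ext_val_mono)+

lemma nf_simulation_Sup:
  assumes "\<And>R. R \<in> A \<Longrightarrow> nf_simulation R"
  shows "nf_simulation (Sup A)"
proof -
  have le: "R \<le> Sup A" if "R \<in> A" for R using that by (rule Sup_upper)
  show ?thesis unfolding nf_simulation_def
  proof (intro allI impI)
    fix t0 t1 assume "Sup A t0 t1"
    then obtain R where R: "R \<in> A" "R t0 t1" by auto
    have s: "nf_simulation R" using assms R(1) .
    show "(\<forall>t0'. red t0 t0' \<longrightarrow> (\<exists>t1'. red\<^sup>*\<^sup>* t1 t1' \<and> Sup A t0' t1')) \<and>
     (\<forall>v0. t0 = Val v0 \<longrightarrow> (\<exists>v1. evals_to t1 (Val v1) \<and> ext_val (Sup A) v0 v1)) \<and>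
     (stuck t0 \<longrightarrow> (\<exists>t1'. evals_to t1 t1' \<and> ext_nf (Sup A) t0 t1'))"
      using s[unfolded nf_simulation_def, rule_format, OF R(2)]
        ext_val_mono[OF _ le[OF R(1)]] ext_nf_mono[OF _ le[OF R(1)]] predicate2D[OF le[OF R(1)]]
      by blast
  qed
qed

lemma nf_bisimulation_nf_bisimilar: "nf_bisimulation nf_bisimilar"
proof -
  let ?A = "{R. nf_bisimulation R}"
  have 1: "nf_bisimilar = Sup ?A" by (auto simp: fun_eq_iff nf_bisimilar_def)
  have 2: "nf_bisimilar\<inverse>\<inverse> = Sup (conversep ` ?A)"
    by (auto simp: fun_eq_iff nf_bisimilar_def)
  have "nf_simulation (Sup ?A)"
    by (rule nf_simulation_Sup) (simp add: nf_bisimulation_def)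
  moreover have "nf_simulation (Sup (conversep ` ?A))"
    by (rule nf_simulation_Sup) (auto simp: nf_bisimulation_def)
  ultimately have "nf_simulation nf_bisimilar" "nf_simulation nf_bisimilar\<inverse>\<inverse>"
    by (simp_all only: 1[symmetric] 2)
  then show ?thesis by (subst nf_bisimulation_def) (rule conjI)
qed

lemma nf_bisimilar_greatest: "nf_bisimulation R \<Longrightarrow> R \<le> nf_bisimilar"
  unfolding nf_bisimilar_def by (intro predicate2I exI[of _ R] conjI)

end

theory Submission
  imports Defs
begin

text \<open>
  The closure \<open>S\<close> of normal-form bisimilarity under substitution of related values, plugging into
  related contexts and the binders is a congruence, so it suffices that \<open>S\<close> is a simulation, which
  is shown by induction on the derivation. When a value \<open>v0\<close> meets an evaluation context \<open>F0\<close>,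
  the term \<open>F0[v0]\<close> is read as \<open>F0[x]\<close> under a substitution, and the only new reductions
  happen where \<open>F0[x]\<close> is stuck on an application \<open>x w\<close>. They are then simulated through
  \<open>v0 x\<close>, but the pair \<open>v0 x\<close>, \<open>v1 x\<close> need not be a premise of the derivation at hand. The
  induction therefore carries along that the reduction and stuckness clauses hold for \<open>v0 x\<close> and
  \<open>v1 x\<close> whenever the left term is a value \<open>v0\<close>.
\<close>


section \<open>Renaming and substitution\<close>

lemma up_ren_simps [simp]: "up_ren r 0 = 0" "up_ren r (Suc n) = Suc (r n)"
  by (simp_all add: up_ren_def)

lemma up_subst_simps [simp]: "up_subst s 0 = Var 0" "up_subst s (Suc n) = ren_val Suc (s n)"
  by (simp_all add: up_subst_def)

lemma up_subst_Var: "up_subst (\<lambda>n. Var (r n)) = (\<lambda>n. Var (up_ren r n))"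
  by (rule ext, rename_tac n, case_tac n) simp_all

lemma ren_eq_subst:
  "ren_trm r t = subst_trm (\<lambda>n. Var (r n)) t"
  "ren_val r v = subst_val (\<lambda>n. Var (r n)) v"
  by (induction t and v arbitrary: r and r) (simp_all add: up_subst_Var)

lemma subst_Var [simp]: "subst_trm Var t = t" "subst_val Var v = v"
  by (simp_all add: subst_fv_id)

lemma subst_ren:
  "subst_trm s (ren_trm r t) = subst_trm (\<lambda>n. s (r n)) t"
  "subst_val s (ren_val r v) = subst_val (\<lambda>n. s (r n)) v"
proof (induction t and v arbitrary: s r and s r)
  case (Shift t)
  have "(\<lambda>n. up_subst s (up_ren r n)) = up_subst (\<lambda>n. s (r n))"
    by (rule ext, rename_tac n, case_tac n) simp_all
  then show ?case using Shift by simp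
next
  case (Lam t)
  have "(\<lambda>n. up_subst s (up_ren r n)) = up_subst (\<lambda>n. s (r n))"
    by (rule ext, rename_tac n, case_tac n) simp_all
  then show ?case using Lam by simp
qed simp_all

lemma ren_ren:
  "ren_trm q (ren_trm r t) = ren_trm (\<lambda>n. q (r n)) t"
  "ren_val q (ren_val r v) = ren_val (\<lambda>n. q (r n)) v"
  by (simp_all only: ren_eq_subst(1)[of q] ren_eq_subst(2)[of q] subst_ren) (simp_all add: ren_eq_subst)

lemma ren_subst:
  "ren_trm r (subst_trm s t) = subst_trm (\<lambda>n. ren_val r (s n)) t"
  "ren_val r (subst_val s v) = subst_val (\<lambda>n. ren_val r (s n)) v"
proof (induction t and v arbitrary: s r and s r)
  case (Shift t)
  have "(\<lambda>n. ren_val (up_ren r) (up_subst s n)) = up_subst (\<lambda>n. ren_val r (s n))"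
    by (rule ext, rename_tac n, case_tac n) (simp_all add: ren_ren)
  then show ?case using Shift by simp
next
  case (Lam t)
  have "(\<lambda>n. ren_val (up_ren r) (up_subst s n)) = up_subst (\<lambda>n. ren_val r (s n))"
    by (rule ext, rename_tac n, case_tac n) (simp_all add: ren_ren)
  then show ?case using Lam by simp
qed simp_all

lemma subst_subst:
  "subst_trm q (subst_trm s t) = subst_trm (\<lambda>n. subst_val q (s n)) t"
  "subst_val q (subst_val s v) = subst_val (\<lambda>n. subst_val q (s n)) v"
proof (induction t and v arbitrary: s q and s q)
  case (Shift t)
  have "(\<lambda>n. subst_val (up_subst q) (up_subst s n)) = up_subst (\<lambda>n. subst_val q (s n))"
    by (rule ext, rename_tac n, case_tac n) (simp_all add: subst_ren ren_subst)
  then show ?case using Shift by simp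
next
  case (Lam t)
  have "(\<lambda>n. subst_val (up_subst q) (up_subst s n)) = up_subst (\<lambda>n. subst_val q (s n))"
    by (rule ext, rename_tac n, case_tac n) (simp_all add: subst_ren ren_subst)
  then show ?case using Lam by simp
qed simp_all

lemma subst_up_ren_Suc:
  "subst_trm (up_subst s) (ren_trm Suc t) = ren_trm Suc (subst_trm s t)"
  "subst_val (up_subst s) (ren_val Suc v) = ren_val Suc (subst_val s v)"
  by (simp_all add: subst_ren ren_subst)

lemma subst_case_nat_ren_Suc [simp]:
  "subst_trm (case_nat v Var) (ren_trm Suc t) = t"
  "subst_val (case_nat v Var) (ren_val Suc w) = w"
  by (simp_all add: subst_ren)

lemma subst_inst: "subst_trm s (inst v t) = inst (subst_val s v) (subst_trm (up_subst s) t)"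
proof -
  have "(\<lambda>n. subst_val s (case_nat v Var n)) =
      (\<lambda>n. subst_val (case_nat (subst_val s v) Var) (up_subst s n))"
    by (rule ext, rename_tac n, case_tac n) simp_all
  then show ?thesis by (simp add: inst_def subst_subst)
qed

lemma inst_Var0_ren_up_Suc [simp]: "inst (Var 0) (ren_trm (up_ren Suc) t) = t"
proof -
  have "(\<lambda>n. case_nat (Var 0) Var (up_ren Suc n)) = Var"
    by (rule ext, rename_tac n, case_tac n) simp_all
  then show ?thesis by (simp add: inst_def subst_ren)
qed

text \<open>Index 0 is fixed by the lifted renaming, so a successor can only come from a successor.
  This handles the binder cases of \<open>fv_ren\<close>.\<close>

lemma Suc_eq_up_ren: "Suc n = up_ren r m \<longleftrightarrow> (\<exists>k. m = Suc k \<and> n = r k)"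
  by (cases m) auto

lemma fv_ren:
  "fv_trm (ren_trm r t) = r ` fv_trm t"
  "fv_val (ren_val r v) = r ` fv_val v"
proof (induction t and v arbitrary: r and r)
  case (Shift t)
  then show ?case by (auto simp: Suc_eq_up_ren image_iff)
next
  case (Lam t)
  then show ?case by (auto simp: Suc_eq_up_ren image_iff)
qed auto

lemma fv_subst:
  "fv_trm (subst_trm s t) = (\<Union>x\<in>fv_trm t. fv_val (s x))"
  "fv_val (subst_val s v) = (\<Union>x\<in>fv_val v. fv_val (s x))"
proof (induction t and v arbitrary: s and s)
  case (Shift t)
  have "Suc n \<in> fv_val (up_subst s x) \<longleftrightarrow> (\<exists>y. x = Suc y \<and> n \<in> fv_val (s y))" for n x
    by (cases x) (auto simp: fv_ren)
  then show ?case using Shift by auto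
next
  case (Lam t)
  have "Suc n \<in> fv_val (up_subst s x) \<longleftrightarrow> (\<exists>y. x = Suc y \<and> n \<in> fv_val (s y))" for n x
    by (cases x) (auto simp: fv_ren)
  then show ?case using Lam by auto
qed auto


section \<open>Evaluation contexts\<close>

primrec subst_ectx :: "(nat \<Rightarrow> val) \<Rightarrow> ectx \<Rightarrow> ectx" where
  "subst_ectx s Hole = Hole"
| "subst_ectx s (AppR v F) = AppR (subst_val s v) (subst_ectx s F)"
| "subst_ectx s (AppL F t) = AppL (subst_ectx s F) (subst_trm s t)"
| "subst_ectx s (ResetE F) = ResetE (subst_ectx s F)"

lemma subst_plug: "subst_trm s (plug F t) = plug (subst_ectx s F) (subst_trm s t)"
  by (induction F) simp_all

lemma ren_ectx_eq_subst: "ren_ectx r F = subst_ectx (\<lambda>n. Var (r n)) F"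
  by (induction F) (simp_all add: ren_eq_subst)

lemma plug_eq_Val_iff: "plug F t = Val v \<longleftrightarrow> F = Hole \<and> t = Val v"
  by (cases F) simp_all

lemma plug_comp: "plug (comp_ectx F G) t = plug F (plug G t)"
  by (induction F) simp_all

lemma comp_Hole [simp]: "comp_ectx F Hole = F"
  by (induction F) simp_all

lemma comp_assoc: "comp_ectx (comp_ectx F G) H = comp_ectx F (comp_ectx G H)"
  by (induction F) simp_all

lemma is_pure_subst [simp]: "is_pure (subst_ectx s F) \<longleftrightarrow> is_pure F"
  by (induction F) simp_all

lemma is_pure_ren [simp]: "is_pure (ren_ectx r F) \<longleftrightarrow> is_pure F"
  by (induction F) simp_all

lemma is_pure_comp [simp]: "is_pure (comp_ectx F G) \<longleftrightarrow> is_pure F \<and> is_pure G"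
  by (induction F) simp_all

lemma subst_comp: "subst_ectx s (comp_ectx F G) = comp_ectx (subst_ectx s F) (subst_ectx s G)"
  by (induction F) simp_all

lemma ren_comp: "ren_ectx r (comp_ectx F G) = comp_ectx (ren_ectx r F) (ren_ectx r G)"
  by (induction F) simp_all

lemma plug_fresh_comp: "plug_fresh (comp_ectx F G) = plug (ren_ectx Suc F) (plug_fresh G)"
  by (simp add: plug_fresh_def ren_comp plug_comp)

lemma subst_up_ren_ectx_Suc:
  "subst_ectx (up_subst s) (ren_ectx Suc F) = ren_ectx Suc (subst_ectx s F)"
  by (induction F) (simp_all add: subst_up_ren_Suc)

lemma subst_plug_fresh: "subst_trm (up_subst s) (plug_fresh F) = plug_fresh (subst_ectx s F)"
  by (simp add: plug_fresh_def subst_plug subst_up_ren_ectx_Suc)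

lemma ren_plug_fresh: "ren_trm (up_ren r) (plug_fresh F) = plug_fresh (ren_ectx r F)"
  using subst_plug_fresh[of "\<lambda>n. Var (r n)" F]
  by (simp add: ren_eq_subst ren_ectx_eq_subst up_subst_Var)

lemma subst_case_nat_plug_fresh: "subst_trm (case_nat v Var) (plug_fresh F) = plug F (Val v)"
proof -
  have "subst_ectx (case_nat v Var) (ren_ectx Suc F) = F"
    by (induction F) simp_all
  then show ?thesis by (simp add: plug_fresh_def subst_plug)
qed

lemma pure_or_reset:
  obtains "is_pure F" | F' E where "is_pure E" "F = comp_ectx F' (ResetE E)"
proof -
  have "is_pure F \<or> (\<exists>F' E. is_pure E \<and> F = comp_ectx F' (ResetE E))"
  proof (induction F)
    case (AppR v F)
    then show ?case by (metis comp_ectx.simps(2) is_pure.simps(2))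
  next
    case (AppL F t)
    then show ?case by (metis comp_ectx.simps(3) is_pure.simps(3))
  next
    case (ResetE F)
    then show ?case by (metis comp_ectx.simps(1,4))
  qed simp
  then show thesis using that by blast
qed

text \<open>Pure contexts contain no reset, so the displayed reset is the innermost one on the path
  to the hole. Hence the context captured by a shift is unique.\<close>

lemma comp_ResetE_inject:
  assumes "is_pure E" "is_pure E'" "comp_ectx F (ResetE E) = comp_ectx F' (ResetE E')"
  shows "F = F' \<and> E = E'"
  using assms
proof (induction F arbitrary: F')
  case Hole
  then show ?case by (cases F') auto
next
  case (AppR v F)
  then show ?case by (cases F') auto
next
  case (AppL F t)
  then show ?case by (cases F') auto
next
  case (ResetE F)
  then show ?case by (cases F') auto
qed


section \<open>Unique decomposition and reduction\<close>

text \<open>A capture is decomposed at its shift and not at its reset, so that the position of a core is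
  the same for redexes and for stuck terms.\<close>

definition core :: "trm \<Rightarrow> bool" where
  "core t \<longleftrightarrow> (\<exists>v w. t = App (Val v) (Val w)) \<or> (\<exists>u. t = Shift u) \<or> (\<exists>v. t = Reset (Val v))"

lemma core_simps [simp]:
  "core (App (Val v) (Val w))" "core (Shift u)" "core (Reset (Val v))" "\<not> core (Val v)"
  by (simp_all add: core_def)

lemma plug_core_not_Val [simp]:
  "core r \<Longrightarrow> plug F r \<noteq> Val v" "core r \<Longrightarrow> Val v \<noteq> plug F r"
  by (cases F; auto simp: core_def)+

text \<open>A term with a core in evaluation position is never a value, and strictly inside a core
  only values stand in evaluation positions. So both paths descend the same way and end at the same
  depth.\<close>

lemma plug_core_inject:
  assumes "core r" "core r'" "plug F r = plug F' r'"
  shows "F = F' \<and> r = r'"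
  using assms
proof (induction F arbitrary: F')
  case Hole
  then show ?case by (cases F') (auto simp: core_def)
next
  case (AppR v F)
  then show ?case by (cases F') (auto simp: core_def)
next
  case (AppL F t)
  then show ?case by (cases F') (auto simp: core_def)
next
  case (ResetE F)
  then show ?case by (cases F') (auto simp: core_def)
qed

lemma value_or_core:
  obtains v where "t = Val v" | F r where "core r" "t = plug F r"
proof -
  \<comment> \<open>The conjunct \<open>True\<close> is the induction predicate for values, as terms
    and values are mutually recursive.\<close>
  have "(\<exists>v. t = Val v) \<or> (\<exists>F r. core r \<and> t = plug F r)" and True for v :: val
  proof (induction t and v)
    case (App t u)
    show ?case
    proof (cases "\<exists>F r. core r \<and> t = plug F r")
      case True
      then show ?thesis by (metis plug.simps(3))
    next
      case False
      then obtain v where v: "t = Val v" using App by blast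
      show ?thesis
      proof (cases "\<exists>F r. core r \<and> u = plug F r")
        case True
        then show ?thesis using v by (metis plug.simps(2))
      next
        case False
        then obtain w where "u = Val w" using App by blast
        then show ?thesis using v by (metis plug.simps(1) core_simps(1))
      qed
    qed
  next
    case (Shift t)
    then show ?case by (metis plug.simps(1) core_simps(2))
  next
    case (Reset t)
    then show ?case by (metis plug.simps(1,4) core_simps(3))
  qed simp_all
  then show thesis using that by blast
qed

text \<open>The capture rule is recast with the shift as core, so that
  \<open>plug_core_inject\<close> can compare any two redexes, and any redex with a stuck
  term.\<close>

lemma red_core_cases:
  assumes "red t t'"
  obtains F b v where "t = plug F (App (Val (Lam b)) (Val v))" "t' = plug F (inst v b)"
  | F E u where "is_pure E" "t = plug (comp_ectx F (ResetE E)) (Shift u)"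
      "t' = plug F (Reset (inst (Lam (Reset (plug_fresh E))) u))"
  | F v where "t = plug F (Reset (Val v))" "t' = plug F (Val v)"
  using assms by (cases rule: red.cases) (auto simp: plug_comp)

lemma red_deterministic:
  assumes "red t t1" "red t t2"
  shows "t1 = t2"
  using assms(1)
proof (cases rule: red_core_cases)
  case 1
  with assms(2) show ?thesis
    by (cases rule: red_core_cases) (auto dest!: plug_core_inject[rotated 2])
next
  case 2
  with assms(2) show ?thesis
    by (cases rule: red_core_cases) (auto dest!: plug_core_inject[rotated 2] comp_ResetE_inject[rotated 2])
next
  case 3
  with assms(2) show ?thesis
    by (cases rule: red_core_cases) (auto dest!: plug_core_inject[rotated 2])
qed

lemma not_red_Val: "\<not> red (Val v) t"
  by (auto elim!: red_core_cases)

lemma not_red_stuck: "stuck t \<Longrightarrow> \<not> red t t'"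
  by (auto simp: stuck_def control_stuck_def open_stuck_def elim!: red_core_cases
      dest!: plug_core_inject[rotated 2])

lemma not_stuck_Val: "\<not> stuck (Val v)"
  by (auto simp: stuck_def control_stuck_def open_stuck_def)

lemma not_control_and_open_stuck: "control_stuck t \<Longrightarrow> \<not> open_stuck t"
  by (auto simp: control_stuck_def open_stuck_def dest!: plug_core_inject[rotated 2])

lemma progress:
  obtains v where "t = Val v" | t' where "red t t'" | "stuck t"
proof (cases rule: value_or_core[of t])
  case 1
  then show ?thesis by (rule that)
next
  case (2 F r)
  then consider v w where "r = App (Val v) (Val w)" | u where "r = Shift u" | v where "r = Reset (Val v)"
    by (auto simp: core_def)
  then show ?thesis
  proof cases
    case (1 v w)
    show ?thesis
    proof (cases v)
      case (Var x)
      then show ?thesis using 1 2 that(3) by (auto simp: stuck_def open_stuck_def)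
    next
      case (Lam b)
      then show ?thesis using 1 2 that(2) red_beta by blast
    qed
  next
    case (2 u)
    show ?thesis
    proof (cases rule: pure_or_reset[of F])
      case 1
      then show ?thesis using 2 \<open>t = plug F r\<close> that(3) by (auto simp: stuck_def control_stuck_def)
    next
      case (2 E F')
      then show ?thesis using \<open>r = Shift u\<close> \<open>t = plug F r\<close> that(2) red_shift by (simp add: plug_comp) blast
    qed
  next
    case (3 v)
    then show ?thesis using 2 that(2) red_reset by blast
  qed
qed

lemma red_plug: "red t t' \<Longrightarrow> red (plug F t) (plug F t')"
  by (induction rule: red.induct) (metis red.intros plug_comp)+

lemma reds_plug: "red\<^sup>*\<^sup>* t t' \<Longrightarrow> red\<^sup>*\<^sup>* (plug F t) (plug F t')"
  by (induction rule: rtranclp_induct) (auto intro: rtranclp.rtrancl_into_rtrancl red_plug)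

lemma red_subst: "red t t' \<Longrightarrow> red (subst_trm s t) (subst_trm s t')"
proof (induction rule: red.induct)
  case (red_shift E F t)
  then show ?case
    using red.red_shift[of "subst_ectx s E" "subst_ectx s F" "subst_trm (up_subst s) t"]
    by (simp add: subst_plug subst_inst subst_plug_fresh)
qed (simp_all add: subst_plug subst_inst red.intros)

lemma reds_subst: "red\<^sup>*\<^sup>* t t' \<Longrightarrow> red\<^sup>*\<^sup>* (subst_trm s t) (subst_trm s t')"
  by (induction rule: rtranclp_induct) (auto intro: rtranclp.rtrancl_into_rtrancl red_subst)

text \<open>A reset keeps its delimiter until its body is a value, which it then returns. Values are
  included so that reduction preserves the class.\<close>

definition delimited :: "trm \<Rightarrow> bool" where
  "delimited t \<longleftrightarrow> (\<exists>v. t = Val v) \<or> (\<exists>u. t = Reset u)"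

lemma delimited_simps [simp]: "delimited (Val v)" "delimited (Reset u)"
  by (simp_all add: delimited_def)

lemma red_delimited: "red t t' \<Longrightarrow> delimited t \<Longrightarrow> delimited t'"
proof (induction rule: red.induct)
  case (red_beta F t v)
  then show ?case by (cases F) (auto simp: delimited_def)
next
  case (red_shift E F t)
  then show ?case by (cases F) (auto simp: delimited_def)
next
  case (red_reset F v)
  then show ?case by (cases F) (auto simp: delimited_def)
qed

text \<open>An application at the top would not be delimited, so \<open>F\<close> is the hole or
  starts with a reset.\<close>

lemma delimited_plug_fresh: "delimited (plug (comp_ectx F (ResetE E)) t) \<Longrightarrow> delimited (plug_fresh F)"
  by (cases F) (auto simp: delimited_def plug_fresh_def)

lemma pure_plug_not_delimited:
  "is_pure F \<Longrightarrow> \<not> delimited (plug F (Shift u))"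
  "is_pure F \<Longrightarrow> \<not> delimited (plug F (App t u))"
  by (cases F; simp add: delimited_def)+

abbreviation app_fresh :: "val \<Rightarrow> trm" where
  "app_fresh v \<equiv> App (Val (ren_val Suc v)) (Val (Var 0))"

lemma subst_app_fresh: "subst_trm (up_subst s) (app_fresh v) = app_fresh (subst_val s v)"
  by (simp add: subst_up_ren_Suc)

lemma ren_app_fresh: "ren_trm (up_ren r) (app_fresh v) = app_fresh (ren_val r v)"
  by (simp add: ren_ren)

text \<open>The beta step with the fresh variable undoes the weakening of the body.\<close>

lemma red_app_fresh_Lam: "red (app_fresh (Lam b)) b"
  using red_beta[of Hole "ren_trm (up_ren Suc) b" "Var 0"] by simp


section \<open>The congruence closure of a simulation\<close>

text \<open>
  For contexts \<open>F0[\<langle>E0\<rangle>]\<close> only \<open>\<langle>E0[x]\<rangle>\<close> and \<open>F0[x]\<close> are tested, hence the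
  separate plugging rules for \<open>\<langle>E0\<rangle>\<close> and for arbitrary \<open>F0\<close>. The latter is restricted to
  values and resets, which never become control-stuck: \<open>F0[x]\<close> says nothing about the part of
  \<open>F0\<close> that a shift in the hole would capture.
\<close>

inductive cong_clos :: "trm_rel \<Rightarrow> trm_rel" for R where
  base: "R t0 t1 \<Longrightarrow> cong_clos R t0 t1"
| subst: "cong_clos R t0 t1 \<Longrightarrow> (\<And>x. cong_clos R (app_fresh (s0 x)) (app_fresh (s1 x))) \<Longrightarrow>
    cong_clos R (subst_trm s0 t0) (subst_trm s1 t1)"
| plug_pure: "is_pure E0 \<Longrightarrow> is_pure E1 \<Longrightarrow> cong_clos R (plug_fresh E0) (plug_fresh E1) \<Longrightarrow>
    cong_clos R t0 t1 \<Longrightarrow> cong_clos R (plug E0 t0) (plug E1 t1)"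
| plug_reset: "is_pure E0 \<Longrightarrow> is_pure E1 \<Longrightarrow>
    cong_clos R (plug_fresh (ResetE E0)) (plug_fresh (ResetE E1)) \<Longrightarrow>
    cong_clos R t0 t1 \<Longrightarrow> cong_clos R (plug (ResetE E0) t0) (plug (ResetE E1) t1)"
| plug_delimited: "delimited t0 \<Longrightarrow> delimited t1 \<Longrightarrow> cong_clos R (plug_fresh F0) (plug_fresh F1) \<Longrightarrow>
    cong_clos R t0 t1 \<Longrightarrow> cong_clos R (plug F0 t0) (plug F1 t1)"
| lam: "cong_clos R t0 t1 \<Longrightarrow> cong_clos R (Val (Lam t0)) (Val (Lam t1))"
| shift: "cong_clos R (Reset t0) (Reset t1) \<Longrightarrow> cong_clos R (Shift t0) (Shift t1)"

text \<open>
  Splitting the simulation clauses: \<open>act_sim\<close> suffices as a hypothesis on the values that are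
  substituted, and it is vacuous for values.
\<close>

definition act_sim :: "trm_rel \<Rightarrow> trm_rel" where
  "act_sim S t0 t1 \<longleftrightarrow>
     (\<forall>t0'. red t0 t0' \<longrightarrow> (\<exists>t1'. red\<^sup>*\<^sup>* t1 t1' \<and> S t0' t1')) \<and>
     (stuck t0 \<longrightarrow> (\<exists>t1'. evals_to t1 t1' \<and> ext_nf S t0 t1'))"

definition val_sim :: "trm_rel \<Rightarrow> trm_rel" where
  "val_sim S t0 t1 \<longleftrightarrow>
     (\<forall>v0. t0 = Val v0 \<longrightarrow>
       (\<exists>v1. red\<^sup>*\<^sup>* t1 (Val v1) \<and> ext_val S v0 v1 \<and> act_sim S (app_fresh v0) (app_fresh v1)))"

lemma ext_nf_stuck:
  assumes "ext_nf S t0 t1"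
  shows "stuck t0" "stuck t1"
  using assms by (cases; unfold stuck_def control_stuck_def open_stuck_def; blast)+

lemma ext_nf_control_stuck:
  assumes "ext_nf S t0 t1" "control_stuck t0"
  shows "control_stuck t1"
  using assms(1)
proof cases
  case (ext_nf_control E0 E1 u0 u1)
  then show ?thesis by (auto simp: control_stuck_def)
next
  case (ext_nf_open F0 F1 v0 v1 y)
  then have "open_stuck t0" by (auto simp: open_stuck_def)
  then show ?thesis using assms(2) not_control_and_open_stuck by blast
qed

lemma act_sim_Val: "act_sim S (Val v) t"
  by (simp add: act_sim_def not_red_Val not_stuck_Val)

text \<open>Reduction is deterministic and a reducible term is not stuck, so one matched step
  settles both clauses.\<close>

lemma act_sim_red:
  assumes "red t0 t0'" "red\<^sup>*\<^sup>* t1 t1'" "S t0' t1'"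
  shows "act_sim S t0 t1"
  unfolding act_sim_def using assms red_deterministic[OF assms(1)] not_red_stuck by blast

lemma act_sim_stuck:
  assumes "ext_nf S t0 t1"
  shows "act_sim S t0 t1"
  using assms ext_nf_stuck[OF assms] not_red_stuck by (auto simp: act_sim_def evals_to_def normal_form_def)

lemma act_sim_expand: "act_sim S t0 t1' \<Longrightarrow> red\<^sup>*\<^sup>* t1 t1' \<Longrightarrow> act_sim S t0 t1"
  unfolding act_sim_def evals_to_def by (meson rtranclp_trans)

lemma val_sim_expand: "val_sim S t0 t1' \<Longrightarrow> red\<^sup>*\<^sup>* t1 t1' \<Longrightarrow> val_sim S t0 t1"
  unfolding val_sim_def by (metis rtranclp_trans)

lemma act_sim_cases:
  assumes "act_sim S t0 t1"
  obtains v where "t0 = Val v"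
  | t0' t1' where "red t0 t0'" "red\<^sup>*\<^sup>* t1 t1'" "S t0' t1'"
  | t1' where "red\<^sup>*\<^sup>* t1 t1'" "ext_nf S t0 t1'"
  using assms by (cases rule: progress[of t0]) (auto simp: act_sim_def evals_to_def)

lemma val_sim_nonvalue: "\<nexists>v. t0 = Val v \<Longrightarrow> val_sim S t0 t1"
  by (simp add: val_sim_def)

text \<open>Only one direction is assumed; for bisimilarity the other one follows from symmetry.
  Reflexivity lets unchanged subterms and variables count as related.\<close>

locale reflexive_simulation =
  fixes R :: trm_rel
  assumes refl: "R t t" and sim: "nf_simulation R"
begin

section \<open>Compatibility of the closure with substitution and the term constructors\<close>

abbreviation S :: trm_rel where "S \<equiv> cong_clos R"

lemma clos_refl: "S t t"
  by (simp add: base refl)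

lemma ext_val_refl: "ext_val S v v"
  by (simp add: ext_val_def clos_refl)

lemma clos_subst:
  assumes "S t0 t1" "\<And>x. ext_val S (s0 x) (s1 x)"
  shows "S (subst_trm s0 t0) (subst_trm s1 t1)"
  using assms by (auto simp: ext_val_def intro: subst)

lemma clos_ren: "S t0 t1 \<Longrightarrow> S (ren_trm r t0) (ren_trm r t1)"
  by (simp add: ren_eq_subst clos_subst ext_val_refl)

lemma ext_val_ren: "ext_val S v0 v1 \<Longrightarrow> ext_val S (ren_val r v0) (ren_val r v1)"
  unfolding ext_val_def using clos_ren[of "app_fresh v0" "app_fresh v1" "up_ren r"]
  by (simp only: ren_app_fresh)

lemma ext_val_up: "(\<And>x. ext_val S (s0 x) (s1 x)) \<Longrightarrow> ext_val S (up_subst s0 x) (up_subst s1 x)"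
  by (cases x) (simp_all add: ext_val_refl ext_val_ren)

lemma ext_val_case_nat: "ext_val S v0 v1 \<Longrightarrow> ext_val S (case_nat v0 Var x) (case_nat v1 Var x)"
  by (cases x) (simp_all add: ext_val_refl)

lemma clos_inst: "S t0 t1 \<Longrightarrow> ext_val S v0 v1 \<Longrightarrow> S (inst v0 t0) (inst v1 t1)"
  unfolding inst_def by (intro clos_subst ext_val_case_nat)

lemma ext_val_subst:
  assumes "ext_val S v0 v1" "\<And>x. ext_val S (s0 x) (s1 x)"
  shows "ext_val S (subst_val s0 v0) (subst_val s1 v1)"
  using clos_subst[of "app_fresh v0" "app_fresh v1" "up_subst s0" "up_subst s1"] assms
  by (simp only: subst_app_fresh ext_val_def[symmetric] ext_val_up)

lemma clos_plug_fresh_subst: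
  assumes "S (plug_fresh F0) (plug_fresh F1)" "\<And>x. ext_val S (s0 x) (s1 x)"
  shows "S (plug_fresh (subst_ectx s0 F0)) (plug_fresh (subst_ectx s1 F1))"
  using clos_subst[OF assms(1), of "up_subst s0" "up_subst s1"] assms(2)
  by (simp add: subst_plug_fresh ext_val_up)

lemma clos_plug_fresh_ren:
  "S (plug_fresh F0) (plug_fresh F1) \<Longrightarrow> S (plug_fresh (ren_ectx r F0)) (plug_fresh (ren_ectx r F1))"
  using clos_ren[of "plug_fresh F0" "plug_fresh F1" "up_ren r"] by (simp add: ren_plug_fresh)

lemma Reset_plug_fresh: "Reset (plug_fresh E) = plug_fresh (ResetE E)"
  by (simp add: plug_fresh_def)

lemma clos_Reset_plug_fresh_subst:
  assumes "S (Reset (plug_fresh F0)) (Reset (plug_fresh F1))" "\<And>x. ext_val S (s0 x) (s1 x)"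
  shows "S (Reset (plug_fresh (subst_ectx s0 F0))) (Reset (plug_fresh (subst_ectx s1 F1)))"
  using clos_plug_fresh_subst[of "ResetE F0" "ResetE F1"] assms by (simp add: Reset_plug_fresh)

lemma ext_ctx_subst:
  assumes "ext_ctx S F0 F1" "\<And>x. ext_val S (s0 x) (s1 x)"
  shows "ext_ctx S (subst_ectx s0 F0) (subst_ectx s1 F1)"
  using assms(1)
proof cases
  case ext_ctx_pure
  then show ?thesis using assms(2) by (simp add: ext_ctx.ext_ctx_pure clos_plug_fresh_subst)
next
  case (ext_ctx_reset E0 E1 G0 G1)
  then show ?thesis using assms(2)
    by (simp add: subst_comp ext_ctx.ext_ctx_reset clos_plug_fresh_subst clos_Reset_plug_fresh_subst)
qed

text \<open>For contexts with a reset, the inner part up to the innermost reset is plugged first.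
  The result is a reset, hence delimited, and may be plugged into the outer part.\<close>

lemma clos_plug:
  assumes "ext_ctx S F0 F1" "S t0 t1"
  shows "S (plug F0 t0) (plug F1 t1)"
  using assms(1)
proof cases
  case ext_ctx_pure
  then show ?thesis using assms(2) by (intro plug_pure)
next
  case (ext_ctx_reset E0 E1 G0 G1)
  have "S (plug (ResetE E0) t0) (plug (ResetE E1) t1)"
    using ext_ctx_reset assms(2) by (intro plug_reset) (simp_all add: Reset_plug_fresh)
  then show ?thesis using ext_ctx_reset by (simp add: plug_comp plug_delimited)
qed

lemma ext_ctx_Hole: "ext_ctx S Hole Hole"
  by (simp add: ext_ctx_pure clos_refl)

text \<open>Two pure pluggings: the arguments go under a fresh variable in function position, which
  relates the contexts that then receive the functions.\<close>

lemma clos_App: "S t0 t1 \<Longrightarrow> S u0 u1 \<Longrightarrow> S (App t0 u0) (App t1 u1)"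
proof -
  assume t: "S t0 t1" and u: "S u0 u1"
  have "S (plug (AppR (Var 0) Hole) (ren_trm Suc u0)) (plug (AppR (Var 0) Hole) (ren_trm Suc u1))"
    using u by (intro plug_pure clos_ren clos_refl) simp_all
  then have "S (plug_fresh (AppL Hole u0)) (plug_fresh (AppL Hole u1))"
    by (simp add: plug_fresh_def)
  from plug_pure[OF _ _ this t] show ?thesis by simp
qed

lemma clos_Reset: "S t0 t1 \<Longrightarrow> S (Reset t0) (Reset t1)"
  using plug_reset[of Hole Hole R t0 t1] by (simp add: clos_refl)

lemma ext_val_Lam: "S t0 t1 \<Longrightarrow> ext_val S (Lam t0) (Lam t1)"
  unfolding ext_val_def ren_trm.simps(1)[symmetric]
  by (intro clos_App clos_refl clos_ren lam)

section \<open>Composition of related contexts\<close>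

lemma clos_plug_fresh_comp_pure:
  assumes "is_pure E0" "is_pure E1" "S (plug_fresh E0) (plug_fresh E1)"
    "S (plug_fresh G0) (plug_fresh G1)"
  shows "S (plug_fresh (comp_ectx E0 G0)) (plug_fresh (comp_ectx E1 G1))"
  using assms by (simp add: plug_fresh_comp plug_pure clos_plug_fresh_ren)

lemma clos_plug_fresh_comp_reset:
  assumes "is_pure E0" "is_pure E1" "S (plug_fresh (ResetE E0)) (plug_fresh (ResetE E1))"
    "S (plug_fresh G0) (plug_fresh G1)"
  shows "S (plug_fresh (comp_ectx (ResetE E0) G0)) (plug_fresh (comp_ectx (ResetE E1) G1))"
  unfolding plug_fresh_comp ren_ectx.simps
  using assms clos_plug_fresh_ren[OF assms(3), of Suc] by (intro plug_reset) simp_all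

lemma ext_ctx_comp_pure_right:
  assumes "ext_ctx S F0 F1" "is_pure E0" "is_pure E1" "S (plug_fresh E0) (plug_fresh E1)"
  shows "ext_ctx S (comp_ectx F0 E0) (comp_ectx F1 E1)"
  using assms(1)
proof cases
  case ext_ctx_pure
  then show ?thesis using assms(2-) by (simp add: ext_ctx.ext_ctx_pure clos_plug_fresh_comp_pure)
next
  case (ext_ctx_reset D0 D1 G0 G1)
  then have "S (plug_fresh (comp_ectx (ResetE D0) E0)) (plug_fresh (comp_ectx (ResetE D1) E1))"
    using assms(2-) by (intro clos_plug_fresh_comp_reset) (simp_all add: Reset_plug_fresh)
  then show ?thesis using ext_ctx_reset assms(2,3)
    by (simp add: comp_assoc ext_ctx.ext_ctx_reset Reset_plug_fresh)
qed

lemma ext_ctx_comp_pure: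
  assumes "is_pure E0" "is_pure E1" "S (plug_fresh E0) (plug_fresh E1)" "ext_ctx S F0 F1"
  shows "ext_ctx S (comp_ectx E0 F0) (comp_ectx E1 F1)"
  using assms(4)
proof cases
  case ext_ctx_pure
  then show ?thesis using assms(1-3) by (simp add: ext_ctx.ext_ctx_pure clos_plug_fresh_comp_pure)
next
  case ext_ctx_reset
  then show ?thesis using assms(1-3)
    by (simp add: comp_assoc[symmetric] ext_ctx.ext_ctx_reset clos_plug_fresh_comp_pure)
qed

lemma ext_ctx_ResetE:
  assumes "is_pure E0" "is_pure E1" "S (plug_fresh (ResetE E0)) (plug_fresh (ResetE E1))"
  shows "ext_ctx S (ResetE E0) (ResetE E1)"
  using ext_ctx_reset[of E0 E1 S Hole Hole] assms by (simp add: Reset_plug_fresh clos_refl)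

text \<open>If the inner contexts are pure, the reset in front becomes the innermost one of the
  composition. Otherwise their innermost reset stays and only the outer part grows.\<close>

lemma ext_ctx_comp_reset:
  assumes "is_pure E0" "is_pure E1" "S (plug_fresh (ResetE E0)) (plug_fresh (ResetE E1))"
    "ext_ctx S F0 F1"
  shows "ext_ctx S (comp_ectx (ResetE E0) F0) (comp_ectx (ResetE E1) F1)"
  using assms(4)
proof cases
  case ext_ctx_pure
  then show ?thesis using assms by (intro ext_ctx_comp_pure_right ext_ctx_ResetE)
next
  case ext_ctx_reset
  then show ?thesis using clos_plug_fresh_comp_reset[OF assms(1-3)]
    by (simp only: comp_assoc[symmetric] ext_ctx.ext_ctx_reset)
qed

text \<open>A pure context around an application is not delimited, so \<open>F0\<close> and
  \<open>F1\<close> split at a reset. Their outer parts filled with a variable are again delimited,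
  as \<open>plug_delimited\<close> demands.\<close>

lemma ext_ctx_comp_delimited:
  assumes "S (plug_fresh G0) (plug_fresh G1)" "ext_ctx S F0 F1"
    "delimited (plug F0 (App u0 u0'))" "delimited (plug F1 (App u1 u1'))"
  shows "ext_ctx S (comp_ectx G0 F0) (comp_ectx G1 F1)"
  using assms(2)
proof cases
  case ext_ctx_pure
  then show ?thesis using assms(3) pure_plug_not_delimited by blast
next
  case (ext_ctx_reset E0 E1 H0 H1)
  then have "delimited (plug_fresh H0)" "delimited (plug_fresh H1)"
    using assms(3,4) delimited_plug_fresh by blast+
  then have "S (plug_fresh (comp_ectx G0 H0)) (plug_fresh (comp_ectx G1 H1))"
    using assms(1) ext_ctx_reset by (simp add: plug_fresh_comp plug_delimited clos_plug_fresh_ren)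
  then show ?thesis using ext_ctx_reset by (simp only: comp_assoc[symmetric] ext_ctx.ext_ctx_reset)
qed

section \<open>Stability of the simulation clauses under substitution and plugging\<close>

text \<open>Reductions and control-stuck terms are stable under substitution. Only an open-stuck
  \<open>y v0\<close> can change, and its behaviour is then dictated by the test of
  \<open>s0 y\<close> against \<open>s1 y\<close> on a fresh variable.\<close>

lemma act_sim_subst:
  assumes "act_sim S t0 t1" "\<nexists>v. t0 = Val v" "\<And>x. ext_val S (s0 x) (s1 x)"
    "\<And>x. act_sim S (app_fresh (s0 x)) (app_fresh (s1 x))"
  shows "act_sim S (subst_trm s0 t0) (subst_trm s1 t1)"
  using assms(1)
proof (cases rule: act_sim_cases)
  case (1 v)
  then show ?thesis using assms(2) by blast
next
  case (2 t0' t1')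
  then show ?thesis using assms(3) by (meson act_sim_red red_subst reds_subst clos_subst)
next
  case (3 t1')
  from 3(2) have "act_sim S (subst_trm s0 t0) (subst_trm s1 t1')"
  proof cases
    case (ext_nf_control E0 E1 u0 u1)
    have "S (Reset (subst_trm (up_subst s0) u0)) (Reset (subst_trm (up_subst s1) u1))"
      using clos_subst[OF ext_nf_control(6), of "up_subst s0" "up_subst s1"] assms(3)
      by (simp add: ext_val_up)
    then show ?thesis using ext_nf_control assms(3)
      by (auto simp: subst_plug intro!: act_sim_stuck ext_nf.ext_nf_control ext_ctx_subst)
  next
    case (ext_nf_open F0 F1 v0 v1 y)
    let ?F0 = "subst_ectx s0 F0" and ?F1 = "subst_ectx s1 F1"
    let ?v0 = "subst_val s0 v0" and ?v1 = "subst_val s1 v1"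
    have F: "ext_ctx S ?F0 ?F1" and v: "ext_val S ?v0 ?v1"
      using ext_nf_open assms(3) by (simp_all add: ext_ctx_subst ext_val_subst)
    \<comment> \<open>Putting \<open>?v1\<close> for the fresh variable turns a run of the test of
      \<open>s1 y\<close> into a run of the actual application.\<close>
    have reds: "red\<^sup>*\<^sup>* (plug ?F1 (App (Val (s1 y)) (Val ?v1))) (plug ?F1 (inst ?v1 u))"
      if "red\<^sup>*\<^sup>* (app_fresh (s1 y)) u" for u
      using reds_plug[OF reds_subst[OF that, of "case_nat ?v1 Var"], of ?F1] by (simp add: inst_def)
    have "act_sim S (plug ?F0 (App (Val (s0 y)) (Val ?v0))) (plug ?F1 (App (Val (s1 y)) (Val ?v1)))"
    proof (cases "s0 y")
      case (Lam b)
      then obtain u where u: "red\<^sup>*\<^sup>* (app_fresh (s1 y)) u" "S b u"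
        using assms(4)[of y] red_app_fresh_Lam[of b] unfolding act_sim_def by auto
      have "S (plug ?F0 (inst ?v0 b)) (plug ?F1 (inst ?v1 u))"
        using F v u(2) by (intro clos_plug clos_inst)
      then show ?thesis using Lam reds[OF u(1)] by (auto intro: act_sim_red red_beta)
    next
      case (Var z)
      have "open_stuck (plug Hole (app_fresh (s0 y)))"
        unfolding open_stuck_def Var by (metis ren_val.simps(1))
      then obtain u where u: "red\<^sup>*\<^sup>* (app_fresh (s1 y)) u" "ext_nf S (app_fresh (s0 y)) u"
        using assms(4)[of y] by (auto simp: act_sim_def evals_to_def stuck_def)
      \<comment> \<open>The left test is itself a core in the empty context, so unique decomposition
        fixes the left side of the \<open>ext_nf\<close> pair: context \<open>Hole\<close>, head
        \<open>Suc z\<close>, argument \<open>Var 0\<close>.\<close>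
      have core: "app_fresh (s0 y) = plug Hole (App (Val (Var (Suc z))) (Val (Var 0)))"
        using Var by simp
      from u(2) obtain G w where G: "ext_ctx S Hole G" and w: "ext_val S (Var 0) w"
        and u_eq: "u = plug G (App (Val (Var (Suc z))) (Val w))"
      proof cases
        case (ext_nf_control E0 E1 u0 u1)
        have "Hole = E0 \<and> App (Val (Var (Suc z))) (Val (Var 0)) = Shift u0"
          by (rule plug_core_inject) (simp_all only: core_simps core[symmetric] ext_nf_control(1))
        then show ?thesis by simp
      next
        case (ext_nf_open G0 G1 w0 w1 y')
        have "Hole = G0 \<and> App (Val (Var (Suc z))) (Val (Var 0)) = App (Val (Var y')) (Val w0)"
          by (rule plug_core_inject) (simp_all only: core_simps core[symmetric] ext_nf_open(1))
        then show ?thesis using that ext_nf_open by auto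
      qed
      \<comment> \<open>Instantiating the fresh variable also lowers the head \<open>Suc z\<close>
        back to \<open>z\<close>.\<close>
      let ?G = "subst_ectx (case_nat ?v1 Var) G"
      have "ext_ctx S (subst_ectx (case_nat ?v0 Var) Hole) ?G"
        by (intro ext_ctx_subst G ext_val_case_nat v)
      then have G': "ext_ctx S Hole ?G" by simp
      have "ext_val S (subst_val (case_nat ?v0 Var) (Var 0)) (subst_val (case_nat ?v1 Var) w)"
        by (intro ext_val_subst w ext_val_case_nat v)
      then have w': "ext_val S ?v0 (subst_val (case_nat ?v1 Var) w)" by simp
      \<comment> \<open>A context split at a reset is never the hole, so only the pure rule can
        relate \<open>Hole\<close> to \<open>?G\<close>. This allows \<open>?G\<close> to be
        appended to \<open>?F1\<close>.\<close>
      from G' have "is_pure ?G \<and> S (plug_fresh Hole) (plug_fresh ?G)"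
      proof cases
        case (ext_ctx_reset E0 E1 H0 H1)
        then show ?thesis by (cases H0) auto
      qed simp
      then have "ext_ctx S (comp_ectx ?F0 Hole) (comp_ectx ?F1 ?G)"
        using F by (intro ext_ctx_comp_pure_right) simp_all
      from ext_nf.ext_nf_open[OF this w', of z]
      have "ext_nf S (plug ?F0 (App (Val (Var z)) (Val ?v0))) (plug ?F1 (inst ?v1 u))"
        by (simp add: u_eq inst_def subst_plug plug_comp)
      then show ?thesis using Var reds[OF u(1)] by (auto intro: act_sim_expand act_sim_stuck)
    qed
    then show ?thesis using ext_nf_open by (simp add: subst_plug)
  qed
  then show ?thesis using 3(1) by (meson act_sim_expand reds_subst)
qed

lemma act_sim_app_fresh_Var: "act_sim S (app_fresh (Var n)) (app_fresh (Var n))"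
  using ext_nf_open[OF ext_ctx_Hole ext_val_refl, of "Suc n" "Var 0"] by (simp add: act_sim_stuck)

text \<open>Weakening is a substitution by variables, whose own tests are open-stuck and match
  themselves, so \<open>act_sim_subst\<close> applies.\<close>

lemma act_sim_app_fresh_up:
  assumes "\<And>x. act_sim S (app_fresh (s0 x)) (app_fresh (s1 x))"
  shows "act_sim S (app_fresh (up_subst s0 x)) (app_fresh (up_subst s1 x))"
proof (cases x)
  case 0
  then show ?thesis using act_sim_app_fresh_Var[of 0] by simp
next
  case (Suc n)
  have "act_sim S (ren_trm (up_ren Suc) (app_fresh (s0 n))) (ren_trm (up_ren Suc) (app_fresh (s1 n)))"
    unfolding ren_eq_subst(1)[of "up_ren Suc"]
    by (intro act_sim_subst assms ext_val_refl act_sim_app_fresh_Var) simp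
  then show ?thesis unfolding ren_app_fresh Suc by simp
qed

text \<open>For values, the carried clause on \<open>app_fresh v0\<close> is moved along the lifted
  substitution. This is again \<open>act_sim_subst\<close>, since an application is not a
  value.\<close>

lemma sim_subst:
  assumes "act_sim S t0 t1 \<and> val_sim S t0 t1" "\<And>x. ext_val S (s0 x) (s1 x)"
    "\<And>x. act_sim S (app_fresh (s0 x)) (app_fresh (s1 x))"
  shows "act_sim S (subst_trm s0 t0) (subst_trm s1 t1) \<and> val_sim S (subst_trm s0 t0) (subst_trm s1 t1)"
proof (cases "\<exists>v. t0 = Val v")
  case True
  then obtain v0 v1 where v: "t0 = Val v0" "red\<^sup>*\<^sup>* t1 (Val v1)" "ext_val S v0 v1"
    "act_sim S (app_fresh v0) (app_fresh v1)"
    using assms(1) by (auto simp: val_sim_def)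
  have "act_sim S (app_fresh (subst_val s0 v0)) (app_fresh (subst_val s1 v1))"
    unfolding subst_app_fresh[symmetric]
    by (intro act_sim_subst v ext_val_up act_sim_app_fresh_up assms) simp
  moreover have "ext_val S (subst_val s0 v0) (subst_val s1 v1)"
    by (intro ext_val_subst v assms)
  moreover have "red\<^sup>*\<^sup>* (subst_trm s1 t1) (Val (subst_val s1 v1))"
    using reds_subst[OF v(2), of s1] by simp
  ultimately show ?thesis using v(1) by (auto simp: act_sim_Val val_sim_def)
next
  case False
  then have "\<nexists>v. subst_trm s0 t0 = Val v" by (cases t0) auto
  then show ?thesis using False assms by (simp add: act_sim_subst val_sim_nonvalue)
qed

text \<open>The common part of the three plugging rules. \<open>P\<close> is an invariant of
  reduction that the rule imposes on the plugged terms; only the case of a stuck term depends on the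
  kind of context and is left to \<open>nf\<close>.\<close>

lemma sim_plug:
  assumes ctx: "act_sim S (plug_fresh F0) (plug_fresh F1) \<and> val_sim S (plug_fresh F0) (plug_fresh F1)"
    and trm: "act_sim S t0 t1 \<and> val_sim S t0 t1"
    and P: "P t0" "P t1" "\<And>u u'. P u \<Longrightarrow> red u u' \<Longrightarrow> P u'"
    and clos: "\<And>u0 u1. P u0 \<Longrightarrow> P u1 \<Longrightarrow> S u0 u1 \<Longrightarrow> S (plug F0 u0) (plug F1 u1)"
    and nf: "\<And>u0 u1. P u0 \<Longrightarrow> P u1 \<Longrightarrow> ext_nf S u0 u1 \<Longrightarrow> act_sim S (plug F0 u0) (plug F1 u1)"
  shows "act_sim S (plug F0 t0) (plug F1 t1) \<and> val_sim S (plug F0 t0) (plug F1 t1)"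
proof -
  have P1: "P t1'" if "red\<^sup>*\<^sup>* t1 t1'" for t1'
    using that by induction (auto intro: P)
  from trm have "act_sim S t0 t1" ..
  then show ?thesis
  proof (cases rule: act_sim_cases)
    case (1 v0)
    then obtain v1 where v: "red\<^sup>*\<^sup>* t1 (Val v1)" "ext_val S v0 v1"
      "act_sim S (app_fresh v0) (app_fresh v1)"
      using trm by (auto simp: val_sim_def)
    have "act_sim S (app_fresh (case_nat v0 Var x)) (app_fresh (case_nat v1 Var x))" for x
      using v(3) act_sim_app_fresh_Var by (simp split: nat.split)
    then have "act_sim S (plug F0 (Val v0)) (plug F1 (Val v1)) \<and> val_sim S (plug F0 (Val v0)) (plug F1 (Val v1))"
      unfolding subst_case_nat_plug_fresh[symmetric] by (intro sim_subst ctx ext_val_case_nat v(2))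
    then show ?thesis using 1 reds_plug[OF v(1)] by (auto intro: act_sim_expand val_sim_expand)
  next
    case (2 t0' t1')
    then have "S (plug F0 t0') (plug F1 t1')" using P P1 clos by blast
    moreover have "\<nexists>v. plug F0 t0 = Val v" using 2 by (auto simp: plug_eq_Val_iff not_red_Val)
    ultimately show ?thesis using 2 by (auto intro: act_sim_red red_plug reds_plug val_sim_nonvalue)
  next
    case (3 t1')
    then have "act_sim S (plug F0 t0) (plug F1 t1')" using P P1 nf by blast
    moreover have "\<nexists>v. plug F0 t0 = Val v"
      using ext_nf_stuck(1)[OF 3(2)] by (auto simp: plug_eq_Val_iff not_stuck_Val)
    ultimately show ?thesis using reds_plug[OF 3(1)] by (auto intro: act_sim_expand val_sim_nonvalue)
  qed
qed

text \<open>A pure context captures and delimits nothing: it just extends the context of the stuck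
  term.\<close>

lemma act_sim_plug_pure_nf:
  assumes E: "is_pure E0" "is_pure E1" "S (plug_fresh E0) (plug_fresh E1)" and "ext_nf S u0 u1"
  shows "act_sim S (plug E0 u0) (plug E1 u1)"
  using assms(4)
proof cases
  case (ext_nf_control D0 D1 b0 b1)
  have "ext_nf S (plug (comp_ectx E0 D0) (Shift b0)) (plug (comp_ectx E1 D1) (Shift b1))"
    using ext_nf_control E by (intro ext_nf.ext_nf_control ext_ctx_comp_pure) simp_all
  then show ?thesis using ext_nf_control by (simp add: plug_comp act_sim_stuck)
next
  case (ext_nf_open G0 G1 v0 v1 y)
  have "ext_nf S (plug (comp_ectx E0 G0) (App (Val (Var y)) (Val v0)))
      (plug (comp_ectx E1 G1) (App (Val (Var y)) (Val v1)))"
    using ext_nf_open E by (intro ext_nf.ext_nf_open ext_ctx_comp_pure)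
  then show ?thesis using ext_nf_open by (simp add: plug_comp act_sim_stuck)
qed

text \<open>A reset around control-stuck terms creates a capture redex on both sides. The captured
  continuations are related as the composed contexts are, so one step on each side leads to related
  instances of the bodies.\<close>

lemma act_sim_plug_reset_nf:
  assumes E: "is_pure E0" "is_pure E1" "S (plug_fresh (ResetE E0)) (plug_fresh (ResetE E1))"
    and "ext_nf S u0 u1"
  shows "act_sim S (plug (ResetE E0) u0) (plug (ResetE E1) u1)"
  using assms(4)
proof cases
  case (ext_nf_control D0 D1 b0 b1)
  let ?k0 = "Lam (Reset (plug_fresh (comp_ectx E0 D0)))"
  let ?k1 = "Lam (Reset (plug_fresh (comp_ectx E1 D1)))"
  \<comment> \<open>As \<open>D0\<close> is pure, the pair is not related by the reset rule of
    \<open>ext_ctx\<close>.\<close>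
  have "S (plug_fresh D0) (plug_fresh D1)"
    using ext_nf_control(5)
  proof cases
    case (ext_ctx_reset C0 C1 F0 F1)
    then show ?thesis using \<open>is_pure D0\<close> by simp
  qed
  then have "S (plug_fresh (comp_ectx (ResetE E0) D0)) (plug_fresh (comp_ectx (ResetE E1) D1))"
    using E by (intro clos_plug_fresh_comp_reset)
  then have "ext_val S ?k0 ?k1" by (intro ext_val_Lam) (simp add: Reset_plug_fresh)
  from clos_inst[OF ext_nf_control(6) this]
  have "S (Reset (inst ?k0 b0)) (Reset (inst ?k1 b1))" by (simp add: inst_def)
  moreover have "red (plug (ResetE E0) u0) (Reset (inst ?k0 b0))"
    using red_shift[of "comp_ectx E0 D0" Hole b0] E ext_nf_control by (simp add: plug_comp)
  moreover have "red (plug (ResetE E1) u1) (Reset (inst ?k1 b1))"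
    using red_shift[of "comp_ectx E1 D1" Hole b1] E ext_nf_control by (simp add: plug_comp)
  ultimately show ?thesis by (blast intro: act_sim_red)
next
  case (ext_nf_open G0 G1 v0 v1 y)
  have "ext_nf S (plug (comp_ectx (ResetE E0) G0) (App (Val (Var y)) (Val v0)))
      (plug (comp_ectx (ResetE E1) G1) (App (Val (Var y)) (Val v1)))"
    using ext_nf_open E by (intro ext_nf.ext_nf_open ext_ctx_comp_reset)
  then show ?thesis using ext_nf_open by (simp add: plug_comp act_sim_stuck)
qed

text \<open>A control-stuck term is not delimited, which leaves the open-stuck case.\<close>

lemma act_sim_plug_delimited_nf:
  assumes F: "S (plug_fresh F0) (plug_fresh F1)" and "delimited u0" "delimited u1" "ext_nf S u0 u1"
  shows "act_sim S (plug F0 u0) (plug F1 u1)"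
  using assms(4)
proof cases
  case (ext_nf_control D0 D1 b0 b1)
  then show ?thesis using assms(2) pure_plug_not_delimited(1) by blast
next
  case (ext_nf_open G0 G1 v0 v1 y)
  have "ext_nf S (plug (comp_ectx F0 G0) (App (Val (Var y)) (Val v0)))
      (plug (comp_ectx F1 G1) (App (Val (Var y)) (Val v1)))"
    using ext_nf_open assms(2,3) by (intro ext_nf.ext_nf_open ext_ctx_comp_delimited[OF F]) auto
  then show ?thesis using ext_nf_open by (simp add: plug_comp act_sim_stuck)
qed

section \<open>The closure is a simulation\<close>

lemma base_act_sim:
  assumes "R t0 t1"
  shows "act_sim S t0 t1"
proof -
  have le: "R \<le> S" by (auto intro: base)
  show ?thesis
    using sim[unfolded nf_simulation_def, rule_format, OF assms] ext_nf_mono[OF _ le]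
    unfolding act_sim_def by (blast intro: base)
qed

lemma cong_clos_sim: "S t0 t1 \<Longrightarrow> act_sim S t0 t1 \<and> val_sim S t0 t1"
proof (induction rule: cong_clos.induct)
  case (base t0 t1)
  have "\<exists>v1. red\<^sup>*\<^sup>* t1 (Val v1) \<and> ext_val R v0 v1" if "t0 = Val v0" for v0
    using sim[unfolded nf_simulation_def, rule_format, OF base] that by (auto simp: evals_to_def)
  \<comment> \<open>For related values of \<open>R\<close> the tests on a fresh variable are
    themselves in \<open>R\<close>, so \<open>base_act_sim\<close> covers them.\<close>
  then have "val_sim S t0 t1"
    unfolding val_sim_def ext_val_def using base_act_sim cong_clos.base by blast
  then show ?case using base_act_sim[OF base] by blast
next
  case (subst t0 t1 s0 s1)
  then show ?case by (intro sim_subst) (simp_all add: ext_val_def)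
next
  case (plug_pure E0 E1 t0 t1)
  show ?case
    by (rule sim_plug[where P = "\<lambda>_. True"])
      (use plug_pure in \<open>auto intro: cong_clos.plug_pure act_sim_plug_pure_nf\<close>)
next
  case (plug_reset E0 E1 t0 t1)
  show ?case
    by (rule sim_plug[where P = "\<lambda>_. True"])
      (use plug_reset in \<open>blast intro: cong_clos.plug_reset act_sim_plug_reset_nf\<close>)+
next
  case (plug_delimited t0 t1 F0 F1)
  show ?case
    by (rule sim_plug[where P = delimited])
      (use plug_delimited in \<open>blast intro: cong_clos.plug_delimited act_sim_plug_delimited_nf red_delimited\<close>)+
next
  case (lam t0 t1)
  \<comment> \<open>Both tests open to the bodies, which the premise of the rule relates.\<close>
  have "act_sim S (app_fresh (Lam t0)) (app_fresh (Lam t1))"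
    using red_app_fresh_Lam lam(1) by (blast intro: act_sim_red)
  then show ?case using ext_val_Lam[OF lam(1)] by (auto simp: act_sim_Val val_sim_def)
next
  case (shift t0 t1)
  have "act_sim S (Shift t0) (Shift t1)"
    using ext_nf_control[OF _ _ ext_ctx_Hole shift(1)] by (simp add: act_sim_stuck)
  then show ?case by (simp add: val_sim_def)
qed

section \<open>Transfer of evaluation results\<close>

lemma clos_reds:
  assumes "red\<^sup>*\<^sup>* t0 t0'" "S t0 t1"
  obtains t1' where "red\<^sup>*\<^sup>* t1 t1'" "S t0' t1'"
proof -
  have "\<exists>t1'. red\<^sup>*\<^sup>* t1 t1' \<and> S t0' t1'"
    using assms
  proof (induction rule: rtranclp_induct)
    case (step u0 u0')
    then obtain u1 where "red\<^sup>*\<^sup>* t1 u1" "S u0 u1" by blast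
    with step(2) show ?case
      using cong_clos_sim[of u0 u1] unfolding act_sim_def by (meson rtranclp_trans)
  qed blast
  then show thesis using that by blast
qed

lemma clos_evals_to_value:
  assumes "S t0 t1" "evals_to t0 u0" "is_value u0"
  shows "\<exists>u1. evals_to t1 u1 \<and> is_value u1"
proof -
  obtain u1 where u1: "red\<^sup>*\<^sup>* t1 u1" "S u0 u1"
    using clos_reds assms unfolding evals_to_def by blast
  then obtain v1 where "red\<^sup>*\<^sup>* u1 (Val v1)"
    using cong_clos_sim[OF u1(2)] assms(3) by (auto simp: val_sim_def is_value_def)
  then have "red\<^sup>*\<^sup>* t1 (Val v1)" using u1(1) by simp
  then show ?thesis by (auto simp: evals_to_def normal_form_def is_value_def)
qed

lemma clos_evals_to_control_stuck:
  assumes "S t0 t1" "evals_to t0 u0" "control_stuck u0"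
  shows "\<exists>u1. evals_to t1 u1 \<and> control_stuck u1"
proof -
  obtain u1 where u1: "red\<^sup>*\<^sup>* t1 u1" "S u0 u1"
    using clos_reds assms unfolding evals_to_def by blast
  then obtain u1' where "evals_to u1 u1'" "ext_nf S u0 u1'"
    using cong_clos_sim[OF u1(2)] assms(3) by (auto simp: act_sim_def stuck_def)
  moreover from this(1) have "evals_to t1 u1'" using u1(1) by (auto simp: evals_to_def)
  ultimately show ?thesis using ext_nf_control_stuck assms(3) by blast
qed

text \<open>The closure relates open terms, so binders may capture. For \<open>CShift\<close>, the
  related resets that the rule \<open>shift\<close> asks for come from
  \<open>clos_Reset\<close>.\<close>

lemma clos_fill: "S t0 t1 \<Longrightarrow> S (fill C t0) (fill C t1)"
  by (induction C) (simp_all add: lam shift clos_App clos_Reset clos_refl)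

end


section \<open>Soundness\<close>

text \<open>Gives reflexivity of bisimilarity. Every context is related to itself, as it is pure or
  splits at its innermost reset.\<close>

lemma nf_simulation_eq: "nf_simulation (=)"
proof -
  have ctx: "ext_ctx (=) F F" for F
    by (cases rule: pure_or_reset[of F]) (auto intro: ext_ctx.intros)
  have nf: "ext_nf (=) t t" if "stuck t" for t
    using that ctx unfolding stuck_def control_stuck_def open_stuck_def
    by (auto intro!: ext_nf.intros simp: ext_val_def)
  show ?thesis
    unfolding nf_simulation_def using nf
    by (auto simp: ext_val_def evals_to_def normal_form_def is_value_def)
qed

lemma nf_bisimilar_refl: "nf_bisimilar t t"
  using nf_simulation_eq unfolding nf_bisimilar_def nf_bisimulation_def
  by (intro exI[of _ "(=)"]) simp

lemma nf_bisimilar_sym: "nf_bisimilar t0 t1 \<Longrightarrow> nf_bisimilar t1 t0"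
  unfolding nf_bisimilar_def nf_bisimulation_def by (metis conversep_conversep conversepI)

interpretation nf_bisimilar: reflexive_simulation nf_bisimilar
  using nf_bisimilar_refl nf_bisimulation_nf_bisimilar
  by unfold_locales (simp_all add: nf_bisimulation_def)

lemma nf_bisimilar_fill_subst:
  "nf_bisimilar t0 t1 \<Longrightarrow> cong_clos nf_bisimilar (fill C (subst_trm s t0)) (fill C (subst_trm s t1))"
  by (intro nf_bisimilar.clos_fill nf_bisimilar.clos_subst base nf_bisimilar.ext_val_refl)

theorem theorem6p7:
  fixes t0 t1 :: trm
  assumes "nf_bisimilar t0 t1"
  shows "open_ctx_equiv t0 t1 \<and> (closed_trm t0 \<and> closed_trm t1 \<longrightarrow> ctx_equiv t0 t1)"
proof -
  have "open_ctx_equiv t0 t1"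
    unfolding open_ctx_equiv_def
  proof (intro allI impI)
    fix s assume s: "\<forall>x \<in> fv_trm t0 \<union> fv_trm t1. closed_val (s x)"
    have closed: "closed_trm (subst_trm s t0)" "closed_trm (subst_trm s t1)"
      using s by (simp_all add: closed_trm_def closed_val_def fv_subst)
    \<comment> \<open>One inclusion of observations for each order of the two terms, the second by
      symmetry of bisimilarity.\<close>
    note S = nf_bisimilar_fill_subst[OF assms] nf_bisimilar_fill_subst[OF nf_bisimilar_sym[OF assms]]
    show "ctx_equiv (subst_trm s t0) (subst_trm s t1)"
      unfolding ctx_equiv_def
      using closed nf_bisimilar.clos_evals_to_value S nf_bisimilar.clos_evals_to_control_stuck
      by blast
  qed
  then show ?thesis using open_ctx_equiv_closed by blast
qed

end
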